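(* Let $n\ge1$, let $g=([n],E)$ be a hypergraph and let $t\in[n]$. Then the local entropic measure on qubit $t$ of the hypergraph state $|g\rangle$ is $$E_2^t(|g\rangle)=\frac14-a^2,\qquad\text{where } a=\frac{1}{2^n}\left[2^{n-1}-2\,hw(g_t)\right]$$ and $g_t$ is the $t$-adjacent subhypergraph of $g$.
   Context: For a positive integer $n$, $[n]=\{1,2,\dots,n\}$. A hypergraph is a pair $(V,E)$ with $V$ a finite set of vertices and $E\subseteq\wp(V)$ (the power set of $V$) a set of hyperedges; the empty hyperedge $\varnothing$ and one-element hyperedges are allowed. To a hypergraph $g=(V,E)$ one associates the Boolean function of the variables $(x_k)_{k\in V}\in\{0,1\}^V$ given by $u(g)(x)=\bigoplus_{e\in E}\prod_{k\in e}x_k$, where $\oplus$ is addition modulo 2 and the empty product equals $1$. The Hamming weight of $g$ is $hw(g)=|\{x\in\{0,1\}^V: u(g)(x)=1\}|$. For $t\in V$, the $t$-adjacent subhypergraph of $g=(V,E)$ is $g_t=(V_t,E_t)$ with $V_t=V\setminus\{t\}$ and $E_t=\{e\setminus\{t\}: e\in E,\ t\in e\}$. The hypergraph state of $g=([n],E)$ is $|g\rangle=\frac{1}{\sqrt{2^n}}\sum_{x\in\{0,1\}^n}(-1)^{u(g)(x)}|x_1\rangle\otimes\cdots\otimes|x_n\rangle\in(\mathbb{C}^2)^{\otimes n}$. For an $n$-qubit pure state (unit vector) $|\phi\rangle$, the local entropic measure on qubit $t$ is $E_2^t(|\phi\rangle)=\det(\rho_t)$, where $\rho_t=\mathrm{Tr}_{\text{all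 but }t}(|\phi\rangle\langle\phi|)$ is the $2\times2$ reduced density matrix obtained by tracing out all qubits except $t$. *)

theory Defs
  imports Complex_Main "HOL-Library.FuncSet" "Jordan_Normal_Form.Determinant"
begin

type_synonym 'a hypergraph = "'a set \<times> 'a set set"

definition is_hypergraph :: "'a hypergraph \<Rightarrow> bool" where
  "is_hypergraph g \<longleftrightarrow> finite (fst g) \<and> snd g \<subseteq> Pow (fst g)"

text \<open>The set of assignments \<open>{0,1}\<^sup>V\<close>; bits are the natural numbers 0 and 1, so that they also
  serve as indices of vectors and matrices. Assignments are extensional, hence determined by their
  values on \<open>V\<close>, and may be counted.\<close>

definition assignments :: "'a set \<Rightarrow> ('a \<Rightarrow> nat) set" where
  "assignments V = V \<rightarrow>\<^sub>E {0, 1}"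

definition boolean_function :: "'a hypergraph \<Rightarrow> ('a \<Rightarrow> nat) \<Rightarrow> nat" where
  "boolean_function g x = (\<Sum>e\<in>snd g. \<Prod>k\<in>e. x k) mod 2"

definition hamming_weight :: "'a hypergraph \<Rightarrow> nat" where
  "hamming_weight g = card {x \<in> assignments (fst g). boolean_function g x = 1}"

definition adjacent_subhypergraph :: "'a \<Rightarrow> 'a hypergraph \<Rightarrow> 'a hypergraph" where
  "adjacent_subhypergraph t g = (fst g - {t}, {e - {t} | e. e \<in> snd g \<and> t \<in> e})"

text \<open>The \<open>n\<close>-fold tensor power of \<open>\<complex>\<^sup>2\<close> is modelled by the complex functions on
  \<open>assignments {1..n}\<close> (coordinates in the computational basis; values at other arguments are
  never used), and operators on it by their matrix entries in that basis.\<close>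

type_synonym qubits_vector = "(nat \<Rightarrow> nat) \<Rightarrow> complex"
type_synonym qubits_operator = "(nat \<Rightarrow> nat) \<Rightarrow> (nat \<Rightarrow> nat) \<Rightarrow> complex"

definition ket :: "nat \<Rightarrow> complex vec" where
  "ket i = unit_vec 2 i"

definition tensor :: "nat \<Rightarrow> (nat \<Rightarrow> complex vec) \<Rightarrow> qubits_vector" where
  "tensor n v = (\<lambda>y. \<Prod>k\<in>{1..n}. v k $ y k)"

definition hypergraph_state :: "nat \<Rightarrow> nat hypergraph \<Rightarrow> qubits_vector" where
  "hypergraph_state n g = (\<lambda>y. complex_of_real (1 / sqrt (2 ^ n)) *
     (\<Sum>x\<in>assignments {1..n}. (- 1) ^ boolean_function g x * tensor n (\<lambda>k. ket (x k)) y))"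

definition projector :: "qubits_vector \<Rightarrow> qubits_operator" where
  "projector \<phi> = (\<lambda>x y. \<phi> x * cnj (\<phi> y))"

definition partial_trace_all_but :: "nat \<Rightarrow> nat \<Rightarrow> qubits_operator \<Rightarrow> complex mat" where
  "partial_trace_all_but n t A =
     mat 2 2 (\<lambda>(i, j). \<Sum>z\<in>assignments ({1..n} - {t}). A (z(t := i)) (z(t := j)))"

definition local_entropic_measure :: "nat \<Rightarrow> nat \<Rightarrow> qubits_vector \<Rightarrow> complex" where
  "local_entropic_measure n t \<phi> = det (partial_trace_all_but n t (projector \<phi>))"

end

(* Writing u for the Boolean function of g, one has u(g)(x with x_t = 1) = u(g)(x with x_t = 0) +
   u(g_t)(x) modulo 2, because the hyperedges that avoid t contribute equally to both sides and
   those through t contribute 0 when x_t = 0. Hence the diagonal entries of the reduced density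
   matrix are 1/2, and both off-diagonal entries are the normalised sum of the signs of u(g_t),
   which counts each assignment once and subtracts twice those on which u(g_t) equals 1. *)

theory Submission
  imports Defs
begin

lemma det_2:
  fixes A :: "'a :: comm_ring_1 mat"
  assumes "A \<in> carrier_mat 2 2"
  shows "det A = A $$ (0, 0) * A $$ (1, 1) - A $$ (0, 1) * A $$ (1, 0)"
  using assms
  by (simp add: laplace_expansion_row [OF assms, of 0] cofactor_def det_single mat_delete_def
      numeral_2_eq_2)

lemma finite_assignments: "finite V \<Longrightarrow> finite (assignments V)"
  by (simp add: assignments_def finite_PiE)

lemma card_assignments: "finite V \<Longrightarrow> card (assignments V) = 2 ^ card V"
  by (simp add: assignments_def card_PiE numeral_2_eq_2)

lemma assignments_upd:
  assumes "z \<in> assignments (V - {t})" "t \<in> V" "i \<in> {0, 1}"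
  shows "z(t := i) \<in> assignments V"
  using assms by (auto simp: assignments_def PiE_iff extensional_def)

text \<open>The tensor is a product of Kronecker deltas, so it vanishes unless \<open>x\<close> and
  \<open>y\<close> agree on all of \<open>{1..n}\<close>; extensionality turns this agreement into
  equality.\<close>

lemma tensor_ket:
  assumes "x \<in> assignments {1..n}" "y \<in> assignments {1..n}"
  shows "tensor n (\<lambda>k. ket (x k)) y = (if x = y then 1 else 0)"
proof -
  \<comment> \<open>The entries of \<open>unit_vec 2\<close> are specified only at indices below
    2.\<close>
  have y: "y k < 2" if "k \<in> {1..n}" for k
    using assms(2) that by (force simp: assignments_def PiE_iff)
  have "tensor n (\<lambda>k. ket (x k)) y = (\<Prod>k\<in>{1..n}. if x k = y k then 1 else 0)"
    unfolding tensor_def by (rule prod.cong) (use y in \<open>auto simp: ket_def unit_vec_def\<close>)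
  also have "\<dots> = (if \<forall>k\<in>{1..n}. x k = y k then 1 else 0)"
    by auto
  also have "(\<forall>k\<in>{1..n}. x k = y k) \<longleftrightarrow> x = y"
    using assms by (auto simp: assignments_def intro: PiE_ext)
  finally show ?thesis .
qed

text \<open>The product kets are the coordinate basis, so only the term \<open>x = y\<close> of the
  defining sum survives.\<close>

lemma hypergraph_state_amplitude:
  assumes "y \<in> assignments {1..n}"
  shows "hypergraph_state n g y = complex_of_real (1 / sqrt (2 ^ n)) * (- 1) ^ boolean_function g y"
proof -
  have "(\<Sum>x\<in>assignments {1..n}. (- 1) ^ boolean_function g x * tensor n (\<lambda>k. ket (x k)) y)
      = (\<Sum>x\<in>assignments {1..n}. if x = y then (- 1) ^ boolean_function g x else 0)"
    using tensor_ket [OF _ assms] by (intro sum.cong) auto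
  also have "\<dots> = (- 1) ^ boolean_function g y"
    using assms by (simp add: finite_assignments)
  finally show ?thesis
    by (simp add: hypergraph_state_def)
qed

text \<open>Removes the reduction modulo 2 from exponents, so that addition modulo 2 becomes
  multiplication of signs.\<close>

lemma minus_one_power_mod_2: "(- 1 :: 'a :: ring_1) ^ (m mod 2) = (- 1) ^ m"
  by (cases "even m") (simp_all add: mod_2_eq_odd)

lemma sign_boolean_function_upd:
  fixes z :: "'a \<Rightarrow> nat"
  assumes "is_hypergraph g"
  shows "(- 1 :: 'b :: ring_1) ^ boolean_function g (z(t := 1)) =
    (- 1) ^ boolean_function g (z(t := 0)) *
    (- 1) ^ boolean_function (adjacent_subhypergraph t g) z"
proof -
  let ?A = "{e \<in> snd g. t \<in> e}" and ?B = "{e \<in> snd g. t \<notin> e}"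
  let ?p = "\<lambda>i e. \<Prod>k\<in>e. (z(t := i)) k"
  have fin_e: "finite e" if "e \<in> snd g" for e
    using assms that unfolding is_hypergraph_def by (meson PowD finite_subset subsetD)
  have finE: "finite (snd g)"
    using assms unfolding is_hypergraph_def by (meson finite_Pow_iff finite_subset)
  have split: "(\<Sum>e\<in>snd g. ?p i e) = (\<Sum>e\<in>?B. ?p i e) + (\<Sum>e\<in>?A. ?p i e)" for i
    using finE by (subst sum.union_disjoint [symmetric]) (auto intro: sum.cong)
  have B: "(\<Sum>e\<in>?B. ?p 1 e) = (\<Sum>e\<in>?B. ?p 0 e)"
    by (intro sum.cong prod.cong) auto
  \<comment> \<open>Each product has the factor 0 at \<open>t\<close>. Finiteness of
    \<open>e\<close> matters here, since a product over an infinite set is 1 by default.\<close>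
  have A0: "(\<Sum>e\<in>?A. ?p 0 e) = 0"
    by (rule sum.neutral) (auto intro!: prod_zero fin_e)
  have edges: "snd (adjacent_subhypergraph t g) = (\<lambda>e. e - {t}) ` ?A"
    by (auto simp: adjacent_subhypergraph_def)
  \<comment> \<open>A hyperedge through \<open>t\<close> is recovered by putting \<open>t\<close>
    back, so deleting \<open>t\<close> merges no two terms of the sum.\<close>
  have inj: "inj_on (\<lambda>e. e - {t}) ?A"
    by (rule inj_onI) blast
  have A1: "(\<Sum>e\<in>?A. ?p 1 e) = (\<Sum>e\<in>snd (adjacent_subhypergraph t g). \<Prod>k\<in>e. z k)"
    unfolding edges sum.reindex [OF inj] o_def
  proof (rule sum.cong)
    fix e assume "e \<in> ?A"
    then have "?p 1 e = (z(t := 1)) t * (\<Prod>k\<in>e - {t}. (z(t := 1)) k)"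
      using fin_e by (intro prod.remove) auto
    also have "(\<Prod>k\<in>e - {t}. (z(t := 1)) k) = (\<Prod>k\<in>e - {t}. z k)"
      by (rule prod.cong) auto
    finally show "?p 1 e = (\<Prod>k\<in>e - {t}. z k)" by simp
  qed simp
  show ?thesis
    unfolding boolean_function_def minus_one_power_mod_2 split A0 B A1
    by (simp add: power_add)
qed

lemma sum_sign_boolean_function:
  assumes "finite (fst h)"
  shows "(\<Sum>z\<in>assignments (fst h). (- 1 :: 'b :: comm_ring_1) ^ boolean_function h z) =
    2 ^ card (fst h) - 2 * of_nat (hamming_weight h)"
proof -
  let ?S = "{z \<in> assignments (fst h). boolean_function h z = 1}"
  \<comment> \<open>The Boolean value is 0 or 1, so its sign is affine in the indicator of the value
    1, and that indicator sums to the Hamming weight.\<close>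
  have "(- 1 :: 'b) ^ boolean_function h z = 1 - 2 * (if boolean_function h z = 1 then 1 else 0)"
    for z
    by (auto simp: boolean_function_def mod_2_eq_odd)
  then have "(\<Sum>z\<in>assignments (fst h). (- 1 :: 'b) ^ boolean_function h z) =
    of_nat (card (assignments (fst h))) -
    2 * (\<Sum>z\<in>assignments (fst h). if boolean_function h z = 1 then 1 else 0)"
    by (simp only: sum_subtractf sum_distrib_left [symmetric]) simp
  also have "(\<Sum>z\<in>assignments (fst h). if boolean_function h z = 1 then 1 else 0) =
      (of_nat (hamming_weight h) :: 'b)"
    using finite_assignments [OF assms]
    by (simp add: hamming_weight_def sum.If_cases Int_def)
  finally show ?thesis
    using assms by (simp add: card_assignments)
qed

theorem mainTheorem3:
  fixes n t :: nat and E :: "nat set set" and g :: "nat hypergraph" and a :: real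
  assumes "n \<ge> 1"
    and "g = ({1..n}, E)"
    and "is_hypergraph g"
    and "t \<in> {1..n}"
    and "a = 1 / 2 ^ n * (2 ^ (n - 1) - 2 * real (hamming_weight (adjacent_subhypergraph t g)))"
  shows "local_entropic_measure n t (hypergraph_state n g) = complex_of_real (1 / 4 - a\<^sup>2)"
proof -
  let ?h = "adjacent_subhypergraph t g"
  let ?Z = "assignments ({1..n} - {t})"
  let ?\<rho> = "partial_trace_all_but n t (projector (hypergraph_state n g))"
  \<comment> \<open>The sign of the amplitude at \<open>z\<close> with qubit \<open>t\<close> set to
    \<open>i\<close>, without the normalising factor.\<close>
  define s where "s i z = (- 1 :: complex) ^ boolean_function g (z(t := i))" for i z
  have V: "fst ?h = {1..n} - {t}"
    using assms(2) by (simp add: adjacent_subhypergraph_def)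
  have cardV: "card ({1..n} - {t}) = n - 1"
    using assms(4) by simp
  have sqrt: "complex_of_real (1 / sqrt (2 ^ n)) * complex_of_real (1 / sqrt (2 ^ n)) = 1 / 2 ^ n"
    by (simp flip: of_real_mult)
  \<comment> \<open>Each entry correlates two sign patterns; the two amplitudes contribute one
    factor \<open>1 / sqrt (2 ^ n)\<close> each.\<close>
  have entry: "?\<rho> $$ (i, j) = 1 / 2 ^ n * (\<Sum>z\<in>?Z. s i z * s j z)"
    if "i \<in> {0, 1}" "j \<in> {0, 1}" for i j
  proof -
    have "?\<rho> $$ (i, j) =
        (\<Sum>z\<in>?Z. projector (hypergraph_state n g) (z(t := i)) (z(t := j)))"
      using that by (auto simp: partial_trace_all_but_def)
    also have "\<dots> = (\<Sum>z\<in>?Z. 1 / 2 ^ n * (s i z * s j z))"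
    proof (rule sum.cong)
      fix z assume "z \<in> ?Z"
      then have amp: "hypergraph_state n g (z(t := k)) = complex_of_real (1 / sqrt (2 ^ n)) * s k z"
        if "k \<in> {0, 1}" for k
        using assignments_upd [OF _ assms(4) that]
        by (simp only: hypergraph_state_amplitude s_def)
      \<comment> \<open>Signs are real, so the conjugate in the projector has no effect.\<close>
      have "cnj (s j z) = s j z"
        by (simp add: s_def)
      then show "projector (hypergraph_state n g) (z(t := i)) (z(t := j)) =
          1 / 2 ^ n * (s i z * s j z)"
        unfolding projector_def amp [OF that(1)] amp [OF that(2)] sqrt [symmetric]
        by (simp only: complex_cnj_mult complex_cnj_complex_of_real mult_ac)
    qed simp
    finally show ?thesis
      by (simp only: sum_distrib_left)
  qed
  have s_sq: "s i z * s i z = 1" for i z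
    by (simp add: s_def flip: power_mult_distrib)
  \<comment> \<open>\<open>s 1 z\<close> is \<open>s 0 z\<close> times the sign of
    \<open>?h\<close>, and the repeated factor \<open>s 0 z\<close> squares to 1.\<close>
  have s01: "s 0 z * s 1 z = (- 1) ^ boolean_function ?h z" for z
    using s_sq [of 0 z] unfolding s_def sign_boolean_function_upd [OF assms(3), of z t]
    by (simp flip: mult.assoc)
  have "card ?Z = 2 ^ (n - 1)"
    by (simp only: card_assignments finite_Diff finite_atLeastAtMost cardV)
  \<comment> \<open>There are \<open>2 ^ (n - 1)\<close> summands, all 1; halving
    \<open>2 ^ n\<close> this way needs \<open>n\<close> positive, because \<open>n - 1\<close>
    truncates at 0.\<close>
  then have diag: "?\<rho> $$ (i, i) = 1 / 2" if "i \<in> {0, 1}" for i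
    unfolding entry [OF that that] s_sq using assms(1) by (cases n) simp_all
  \<comment> \<open>The sign sum of \<open>?h\<close>, over \<open>n - 1\<close> vertices, is the
    bracket in the definition of \<open>a\<close>.\<close>
  have off: "?\<rho> $$ (0, 1) = complex_of_real a"
    using sum_sign_boolean_function [of ?h, where 'b = complex]
    unfolding V cardV by (simp add: entry s01 [unfolded One_nat_def] assms(5))
  have off': "?\<rho> $$ (1, 0) = ?\<rho> $$ (0, 1)"
    by (simp add: entry mult.commute)
  have "local_entropic_measure n t (hypergraph_state n g) =
      ?\<rho> $$ (0, 0) * ?\<rho> $$ (1, 1) - ?\<rho> $$ (0, 1) * ?\<rho> $$ (1, 0)"
    unfolding local_entropic_measure_def
    by (rule det_2) (simp add: partial_trace_all_but_def)
  also have "\<dots> = complex_of_real (1 / 4 - a\<^sup>2)"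
    unfolding off' off diag [OF insertI1] diag [OF insertI2, OF singletonI]
    by (simp add: power2_eq_square)
  finally show ?thesis .
qed

end
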